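(* Let $\Lambda$ be a numerical semigroup of embedding dimension $n\ge 2$ and let $I$ be an irreducible ideal of $\Lambda$. If the graph $G_I(\Lambda)$ has order $6$, then it is isomorphic to one of the following six graphs on the vertex set $\{1,\dots,6\}$ (where $ij$ denotes the edge $\{i,j\}$): $H_1$, with degree sequence $(1,2,3,3,4,5)$ and edges $12,23,24,25,26,34,36,46,56$; $H_2$, with degree sequence $(2,3,3,4,5,5)$ and edges $12,15,23,24,25,26,35,36,45,46,56$; $H_3$, with degree sequence $(2,3,4,4,4,5)$ and edges $12,15,23,24,25,26,34,35,36,45,46$; $H_4$, with degree sequence $(3,3,4,4,5,5)$ and edges $12,13,14,15,16,23,24,25,26,36,45,46$; $H_5$, with degree sequence $(3,4,4,4,4,5)$ and edges $12,14,15,23,24,25,26,34,35,36,46,56$; $H_6$, with degree sequence $(4,4,4,4,5,5)$ and edges $12,14,15,16,23,24,25,26,34,35,36,46,56$.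
   Context: A numerical semigroup is a submonoid $\Lambda$ of $(\mathbb{Z}_{\ge 0},+)$ with finite complement; its embedding dimension is the cardinality of its minimal system of generators. An ideal of $\Lambda$ is a nonempty subset $I\subset\Lambda$ with $I+\Lambda\subset I$. It is irreducible if it is a proper ideal that cannot be written as an intersection of two or more proper ideals each properly containing it. (Known fact, due to Barucci: every irreducible ideal of $\Lambda$ has the form $\Lambda\setminus B(x)$ for some $x\in\Lambda$, where $B(x)=\{y\in\Lambda: x-y\in\Lambda\}$.) The graph $G_I(\Lambda)$ is the simple graph with vertex set $\{v_i : i\in(\Lambda\setminus I)\setminus\{0\}\}$ in which distinct vertices $v_i,v_j$ are adjacent if and only if $i+j\in I$. The order of a graph is its number of vertices. *)

theory Defs
  imports "Graph_Theory.Graph_Theory" "HOL-Library.Multiset"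
begin

section \<open>Numerical semigroups\<close>

definition nat_submonoid :: "nat set \<Rightarrow> bool" where
  "nat_submonoid M \<longleftrightarrow> 0 \<in> M \<and> (\<forall>a\<in>M. \<forall>b\<in>M. a + b \<in> M)"

definition numerical_semigroup :: "nat set \<Rightarrow> bool" where
  "numerical_semigroup \<Lambda> \<longleftrightarrow> nat_submonoid \<Lambda> \<and> finite (UNIV - \<Lambda>)"

definition generated_submonoid :: "nat set \<Rightarrow> nat set" where
  "generated_submonoid A = \<Inter>{M. nat_submonoid M \<and> A \<subseteq> M}"

definition minimal_generating_system :: "nat set \<Rightarrow> nat set \<Rightarrow> bool" where
  "minimal_generating_system \<Lambda> A \<longleftrightarrow>
     generated_submonoid A = \<Lambda> \<and> (\<forall>B. B \<subset> A \<longrightarrow> generated_submonoid B \<noteq> \<Lambda>)"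

text \<open>The description operator is justified by \<open>ex1_minimal_generating_system\<close> below; that the
  cardinality is the true one follows from \<open>finite_minimal_generating_system\<close>.\<close>

definition embedding_dimension :: "nat set \<Rightarrow> nat" where
  "embedding_dimension \<Lambda> = card (THE A. minimal_generating_system \<Lambda> A)"

lemma nat_submonoid_generated: "nat_submonoid (generated_submonoid A)"
  unfolding generated_submonoid_def nat_submonoid_def by blast

lemma generated_submonoid_superset: "A \<subseteq> generated_submonoid A"
  unfolding generated_submonoid_def by blast

lemma generated_submonoid_least:
  "nat_submonoid M \<Longrightarrow> A \<subseteq> M \<Longrightarrow> generated_submonoid A \<subseteq> M"
  unfolding generated_submonoid_def by blast

definition atoms :: "nat set \<Rightarrow> nat set" where
  "atoms \<Lambda> = {x \<in> \<Lambda>. x \<noteq> 0 \<and> (\<forall>a\<in>\<Lambda>. \<forall>b\<in>\<Lambda>. x = a + b \<longrightarrow> a = 0 \<or> b = 0)}"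

lemma generated_atoms:
  assumes "nat_submonoid \<Lambda>"
  shows "generated_submonoid (atoms \<Lambda>) = \<Lambda>"
proof
  show "generated_submonoid (atoms \<Lambda>) \<subseteq> \<Lambda>"
    by (rule generated_submonoid_least[OF assms]) (auto simp: atoms_def)
  have "x \<in> \<Lambda> \<Longrightarrow> x \<in> generated_submonoid (atoms \<Lambda>)" for x
  proof (induction x rule: less_induct)
    case (less x)
    show ?case
    proof (cases "x = 0 \<or> x \<in> atoms \<Lambda>")
      case True
      then show ?thesis
        using nat_submonoid_generated[of "atoms \<Lambda>"] generated_submonoid_superset[of "atoms \<Lambda>"]
        by (auto simp: nat_submonoid_def)
    next
      case False
      then obtain a b where ab: "a \<in> \<Lambda>" "b \<in> \<Lambda>" "x = a + b" "a \<noteq> 0" "b \<noteq> 0"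
        using less.prems by (auto simp: atoms_def)
      then have "a \<in> generated_submonoid (atoms \<Lambda>)" "b \<in> generated_submonoid (atoms \<Lambda>)"
        using less.IH by auto
      then show ?thesis
        using ab(3) nat_submonoid_generated[of "atoms \<Lambda>"] by (auto simp: nat_submonoid_def)
    qed
  qed
  then show "\<Lambda> \<subseteq> generated_submonoid (atoms \<Lambda>)" by blast
qed

lemma atoms_subset_generators:
  assumes "generated_submonoid A = \<Lambda>"
  shows "atoms \<Lambda> \<subseteq> A"
proof
  fix x assume x: "x \<in> atoms \<Lambda>"
  show "x \<in> A"
  proof (rule ccontr)
    assume "x \<notin> A"
    have "nat_submonoid \<Lambda>" using nat_submonoid_generated[of A] assms by simp
    then have "nat_submonoid (\<Lambda> - {x})"
      using x unfolding nat_submonoid_def atoms_def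
      by (smt (verit) DiffE DiffI add.left_neutral add.right_neutral mem_Collect_eq singletonD singletonI)
    moreover have "A \<subseteq> \<Lambda> - {x}"
      using \<open>x \<notin> A\<close> generated_submonoid_superset[of A] assms by auto
    ultimately have "\<Lambda> \<subseteq> \<Lambda> - {x}" using generated_submonoid_least assms by blast
    then show False using x by (auto simp: atoms_def)
  qed
qed

lemma minimal_generating_system_iff:
  assumes "nat_submonoid \<Lambda>"
  shows "minimal_generating_system \<Lambda> A \<longleftrightarrow> A = atoms \<Lambda>"
  using generated_atoms[OF assms] atoms_subset_generators
  unfolding minimal_generating_system_def by (metis psubsetI psubset_eq subset_antisym)

lemma ex1_minimal_generating_system:
  "numerical_semigroup \<Lambda> \<Longrightarrow> \<exists>!A. minimal_generating_system \<Lambda> A"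
  by (simp add: numerical_semigroup_def minimal_generating_system_iff)

lemma finite_minimal_generating_system:
  assumes "numerical_semigroup \<Lambda>" "minimal_generating_system \<Lambda> A"
  shows "finite A"
proof -
  have sub: "nat_submonoid \<Lambda>" and fin: "finite (UNIV - \<Lambda>)"
    using assms(1) by (auto simp: numerical_semigroup_def)
  obtain m where m: "m \<in> \<Lambda>" "m > 0"
  proof -
    have "infinite (UNIV - insert 0 (UNIV - \<Lambda>) :: nat set)"
      using fin by (metis finite_insert Diff_infinite_finite infinite_UNIV_nat)
    then obtain m where "m \<in> UNIV - insert 0 (UNIV - \<Lambda>)"
      by (metis ex_in_conv finite.emptyI)
    then show ?thesis using that by auto
  qed
  have "atoms \<Lambda> \<subseteq> {..m} \<union> (\<lambda>y. y + m) ` (UNIV - \<Lambda>)"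
  proof
    fix x assume x: "x \<in> atoms \<Lambda>"
    show "x \<in> {..m} \<union> (\<lambda>y. y + m) ` (UNIV - \<Lambda>)"
    proof (cases "x \<le> m")
      case False
      then have "x = (x - m) + m" "x - m \<noteq> 0" by auto
      then have "x - m \<notin> \<Lambda>" using x m unfolding atoms_def
        by (metis (mono_tags, lifting) less_irrefl mem_Collect_eq)
      then show ?thesis using \<open>x = (x - m) + m\<close> by blast
    qed simp
  qed
  then have "finite (atoms \<Lambda>)" using fin by (meson finite_UnI finite_atMost finite_imageI finite_subset)
  then show ?thesis using assms(2) minimal_generating_system_iff[OF sub] by simp
qed


section \<open>Ideals\<close>

definition semigroup_ideal :: "nat set \<Rightarrow> nat set \<Rightarrow> bool" where
  "semigroup_ideal \<Lambda> I \<longleftrightarrow> I \<noteq> {} \<and> I \<subseteq> \<Lambda> \<and> (\<forall>i\<in>I. \<forall>l\<in>\<Lambda>. i + l \<in> I)"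

definition proper_ideal :: "nat set \<Rightarrow> nat set \<Rightarrow> bool" where
  "proper_ideal \<Lambda> I \<longleftrightarrow> semigroup_ideal \<Lambda> I \<and> I \<noteq> \<Lambda>"

text \<open>The condition \<open>card F \<ge> 2\<close> restricts to finite families. This is no loss: an ideal
  of a numerical semigroup has finite complement, so only finitely many ideals lie above it.\<close>

definition irreducible_ideal :: "nat set \<Rightarrow> nat set \<Rightarrow> bool" where
  "irreducible_ideal \<Lambda> I \<longleftrightarrow>
     proper_ideal \<Lambda> I \<and>
     \<not> (\<exists>F. card F \<ge> 2 \<and> (\<forall>J\<in>F. proper_ideal \<Lambda> J \<and> I \<subset> J) \<and> I = \<Inter>F)"

lemma finite_compl_ideal:
  assumes "numerical_semigroup \<Lambda>" "semigroup_ideal \<Lambda> I"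
  shows "finite (UNIV - I)"
proof -
  obtain x where x: "x \<in> I" using assms(2) by (auto simp: semigroup_ideal_def)
  have "UNIV - I \<subseteq> {..x} \<union> (\<lambda>y. x + y) ` (UNIV - \<Lambda>)"
  proof
    fix z assume z: "z \<in> UNIV - I"
    show "z \<in> {..x} \<union> (\<lambda>y. x + y) ` (UNIV - \<Lambda>)"
    proof (cases "z \<le> x")
      case False
      then have eq: "z = x + (z - x)" by simp
      then have "z - x \<notin> \<Lambda>" using z x assms(2) by (metis DiffD2 semigroup_ideal_def)
      then show ?thesis using eq by blast
    qed simp
  qed
  then show ?thesis
    using assms(1) by (meson finite_UnI finite_atMost finite_imageI finite_subset numerical_semigroup_def)
qed


section \<open>Graphs\<close>

text \<open>A simple graph is represented as a symmetric, loop-free digraph without parallel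
  arcs (locale \<open>pair_graph\<close>): an edge \<open>{u, v}\<close> is the pair of arcs \<open>(u, v)\<close>, \<open>(v, u)\<close>.
  Isomorphism \<open>digraph_iso\<close> of such digraphs is isomorphism of simple graphs, and the
  degree of a vertex is its \<open>out_degree\<close>. The vertex \<open>v\<^sub>i\<close> is represented by \<open>i\<close> itself.\<close>

definition ideal_graph :: "nat set \<Rightarrow> nat set \<Rightarrow> nat pair_pre_digraph" where
  "ideal_graph \<Lambda> I =
     \<lparr> pverts = (\<Lambda> - I) - {0},
       parcs = {(i, j). i \<in> (\<Lambda> - I) - {0} \<and> j \<in> (\<Lambda> - I) - {0} \<and> i \<noteq> j \<and> i + j \<in> I} \<rparr>"

definition graph_of_edges :: "nat set \<Rightarrow> (nat \<times> nat) set \<Rightarrow> nat pair_pre_digraph" where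
  "graph_of_edges V E = \<lparr> pverts = V, parcs = E \<union> E\<inverse> \<rparr>"

definition degree_sequence :: "('a, 'b) pre_digraph \<Rightarrow> nat list" where
  "degree_sequence G = sorted_list_of_multiset (image_mset (out_degree G) (mset_set (verts G)))"

definition H1 :: "nat pair_pre_digraph" where
  "H1 = graph_of_edges {1..6}
     {(1,2), (2,3), (2,4), (2,5), (2,6), (3,4), (3,6), (4,6), (5,6)}"

definition H2 :: "nat pair_pre_digraph" where
  "H2 = graph_of_edges {1..6}
     {(1,2), (1,5), (2,3), (2,4), (2,5), (2,6), (3,5), (3,6), (4,5), (4,6), (5,6)}"

definition H3 :: "nat pair_pre_digraph" where
  "H3 = graph_of_edges {1..6}
     {(1,2), (1,5), (2,3), (2,4), (2,5), (2,6), (3,4), (3,5), (3,6), (4,5), (4,6)}"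

definition H4 :: "nat pair_pre_digraph" where
  "H4 = graph_of_edges {1..6}
     {(1,2), (1,3), (1,4), (1,5), (1,6), (2,3), (2,4), (2,5), (2,6), (3,6), (4,5), (4,6)}"

definition H5 :: "nat pair_pre_digraph" where
  "H5 = graph_of_edges {1..6}
     {(1,2), (1,4), (1,5), (2,3), (2,4), (2,5), (2,6), (3,4), (3,5), (3,6), (4,6), (5,6)}"

definition H6 :: "nat pair_pre_digraph" where
  "H6 = graph_of_edges {1..6}
     {(1,2), (1,4), (1,5), (1,6), (2,3), (2,4), (2,5), (2,6), (3,4), (3,5), (3,6), (4,6), (5,6)}"

lemma pair_graph_ideal_graph:
  assumes "numerical_semigroup \<Lambda>" "semigroup_ideal \<Lambda> I"
  shows "pair_graph (ideal_graph \<Lambda> I)"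
proof -
  have fin: "finite (\<Lambda> - I - {0})"
    using finite_compl_ideal[OF assms] by (rule rev_finite_subset) auto
  have "parcs (ideal_graph \<Lambda> I) \<subseteq> (\<Lambda> - I - {0}) \<times> (\<Lambda> - I - {0})"
    by (auto simp: ideal_graph_def)
  then have "finite (parcs (ideal_graph \<Lambda> I))"
    using fin by (meson finite_SigmaI finite_subset)
  moreover have "symmetric (with_proj (ideal_graph \<Lambda> I))"
    by (auto simp: symmetric_def ideal_graph_def add.commute intro!: symI)
  ultimately show ?thesis
    using fin by unfold_locales (auto simp: ideal_graph_def)
qed

lemma pair_graph_graph_of_edges:
  assumes "finite V" "E \<subseteq> V \<times> V" "\<And>v. (v, v) \<notin> E"
  shows "pair_graph (graph_of_edges V E)"
proof -
  have "finite E" using assms by (meson finite_SigmaI finite_subset)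
  moreover have "symmetric (with_proj (graph_of_edges V E))"
    by (auto simp: symmetric_def graph_of_edges_def intro!: symI)
  ultimately show ?thesis
    using assms by unfold_locales (auto simp: graph_of_edges_def)
qed

end

theory Submission
  imports Defs
begin

text \<open>With \<open>I = \<Lambda> \<setminus> B(x)\<close>, the map \<open>y \<mapsto> x - y\<close> is an involution on the five vertices other than
  \<open>x\<close>. Hence it has a fixed point \<open>c\<close>, and the vertices are \<open>a < b < c < x - b < x - a < x\<close> with
  \<open>x = 2 c\<close>; a case distinction on the linear relations between \<open>a\<close>, \<open>b\<close>, \<open>c\<close> remains.\<close>

section \<open>Irreducible ideals as complements of divisor sets\<close>

text \<open>If \<open>x - (i + l)\<close> lies in \<open>\<Lambda>\<close>, adding \<open>l\<close>
  shows that \<open>x - i\<close> does too. The conjunct \<open>y \<le> x\<close> guards against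
  truncated subtraction, which would give \<open>x - y = 0\<close> for \<open>y > x\<close>.\<close>

lemma semigroup_ideal_minus_divisors:
  assumes "numerical_semigroup \<Lambda>"
  shows "semigroup_ideal \<Lambda> {y \<in> \<Lambda>. \<not> (y \<le> x \<and> x - y \<in> \<Lambda>)}" (is "semigroup_ideal \<Lambda> ?J")
  unfolding semigroup_ideal_def
proof (intro conjI ballI)
  have sub: "0 \<in> \<Lambda>" "\<And>a b. a \<in> \<Lambda> \<Longrightarrow> b \<in> \<Lambda> \<Longrightarrow> a + b \<in> \<Lambda>" and fin: "finite (UNIV - \<Lambda>)"
    using assms by (auto simp: numerical_semigroup_def nat_submonoid_def)
  have "infinite (UNIV - ((UNIV - \<Lambda>) \<union> {..x}))"
    using fin by (intro Diff_infinite_finite) auto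
  then obtain y where "y \<in> UNIV - ((UNIV - \<Lambda>) \<union> {..x})"
    by (metis ex_in_conv finite.emptyI)
  then have "y \<in> ?J" by auto
  then show "?J \<noteq> {}" by blast
  show "?J \<subseteq> \<Lambda>" by auto
  fix i l assume i: "i \<in> ?J" and l: "l \<in> \<Lambda>"
  have "i \<le> x \<and> x - i \<in> \<Lambda>" if h: "i + l \<le> x" "x - (i + l) \<in> \<Lambda>"
  proof -
    have "x - i = (x - (i + l)) + l" using h by simp
    then show ?thesis using sub(2)[OF h(2) l] h(1) by simp
  qed
  then show "i + l \<in> ?J" using i l sub(2) by blast
qed

text \<open>Every ideal \<open>I\<close> is the intersection of the ideals \<open>\<Lambda> \<setminus> B(x)\<close> with \<open>x \<in> \<Lambda> \<setminus> I\<close>, so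
  irreducibility forces one of them to be \<open>I\<close> itself.\<close>

lemma irreducible_ideal_form:
  assumes "numerical_semigroup \<Lambda>" "irreducible_ideal \<Lambda> I"
  obtains x where "x \<in> \<Lambda>" "I = {y \<in> \<Lambda>. \<not> (y \<le> x \<and> x - y \<in> \<Lambda>)}"
proof -
  define J where "J x = {y \<in> \<Lambda>. \<not> (y \<le> x \<and> x - y \<in> \<Lambda>)}" for x
  have z: "0 \<in> \<Lambda>" using assms(1) by (auto simp: numerical_semigroup_def nat_submonoid_def)
  have I: "semigroup_ideal \<Lambda> I" "I \<noteq> \<Lambda>" "I \<subseteq> \<Lambda>"
    using assms(2) by (auto simp: irreducible_ideal_def proper_ideal_def semigroup_ideal_def)
  have fin: "finite (\<Lambda> - I)"
    using finite_compl_ideal[OF assms(1) I(1)] by (rule rev_finite_subset) auto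
  have ne: "\<Lambda> - I \<noteq> {}" using I by auto
  have sub: "I \<subseteq> J x" if "x \<in> \<Lambda> - I" for x
  proof
    fix y assume y: "y \<in> I"
    have "\<not> (y \<le> x \<and> x - y \<in> \<Lambda>)"
    proof
      assume "y \<le> x \<and> x - y \<in> \<Lambda>"
      then have "y + (x - y) \<in> I" "y + (x - y) = x"
        using y I(1) unfolding semigroup_ideal_def by (blast, simp)
      then show False using that by auto
    qed
    then show "y \<in> J x" using y I(3) by (auto simp: J_def)
  qed
  have proper: "proper_ideal \<Lambda> (J x)" if "x \<in> \<Lambda>" for x
  proof -
    have "x \<notin> J x" using z by (simp add: J_def)
    then show ?thesis
      using semigroup_ideal_minus_divisors[OF assms(1), of x] that
      unfolding proper_ideal_def J_def by blast
  qed
  have inter: "I = \<Inter>(J ` (\<Lambda> - I))"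
  proof
    show "\<Inter>(J ` (\<Lambda> - I)) \<subseteq> I"
    proof
      fix y assume y: "y \<in> \<Inter>(J ` (\<Lambda> - I))"
      then have "y \<in> \<Lambda>" using ne by (auto simp: J_def)
      moreover have "y \<notin> J y" using z by (simp add: J_def)
      ultimately show "y \<in> I" using y by blast
    qed
  qed (use sub in blast)
  have "\<exists>x \<in> \<Lambda> - I. J x = I"
  proof (rule ccontr)
    assume no: "\<not> (\<exists>x \<in> \<Lambda> - I. J x = I)"
    then have neq: "J x \<noteq> I" if "x \<in> \<Lambda> - I" for x using that by metis
    \<comment> \<open>A family with a single member equals its intersection, so that member would be
      \<open>I\<close>. Finiteness matters here because \<open>card\<close> of an infinite set is
      0.\<close>
    have "card (J ` (\<Lambda> - I)) \<ge> 2"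
    proof (rule ccontr)
      assume "\<not> card (J ` (\<Lambda> - I)) \<ge> 2"
      moreover have "card (J ` (\<Lambda> - I)) > 0" using fin ne by (simp add: card_gt_0_iff)
      ultimately have "card (J ` (\<Lambda> - I)) = 1" by simp
      then obtain K where K: "J ` (\<Lambda> - I) = {K}" by (rule card_1_singletonE)
      then have "K = I" using inter by simp
      obtain y where y: "y \<in> \<Lambda> - I" using ne by auto
      then have "J y \<in> J ` (\<Lambda> - I)" by (rule imageI)
      then show False using K \<open>K = I\<close> neq[OF y] by simp
    qed
    moreover have "\<forall>K \<in> J ` (\<Lambda> - I). proper_ideal \<Lambda> K \<and> I \<subset> K"
    proof
      fix K assume "K \<in> J ` (\<Lambda> - I)"
      then obtain x where x: "x \<in> \<Lambda> - I" "K = J x" by (rule imageE)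
      have "I \<subset> J x" using sub[OF x(1)] neq[OF x(1)] by auto
      then show "proper_ideal \<Lambda> K \<and> I \<subset> K" using proper[of x] x by simp
    qed
    ultimately show False
      using assms(2) inter unfolding irreducible_ideal_def by (meson conjI exI)
  qed
  then show thesis using that unfolding J_def by blast
qed

section \<open>The shape of a vertex set of size six\<close>

text \<open>Removing the least element \<open>m\<close> together with \<open>x - m\<close> leaves a
  set that is still symmetric. Doing this twice to the five elements other than \<open>x\<close>
  leaves one element, which must be its own mirror image.\<close>

lemma involution_card_6:
  fixes x :: nat
  assumes "card V = 6" "x \<in> V" "0 \<notin> V"
    and invol: "\<And>y. y \<in> V \<Longrightarrow> y \<noteq> x \<Longrightarrow> y < x \<and> x - y \<in> V"
  obtains a b c where "0 < a" "a < b" "b < c" "x = 2 * c"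
    "V = {a, b, c, 2 * c - b, 2 * c - a, 2 * c}"
proof -
  have peel:
    "\<exists>m. 2 * m < x \<and> 0 < m \<and> m \<in> T \<and> x - m \<in> T \<and> (\<forall>y \<in> T. m \<le> y)
      \<and> card (T - {m, x - m}) + 2 = card T
      \<and> (\<forall>y \<in> T - {m, x - m}. 0 < y \<and> y < x \<and> x - y \<in> T - {m, x - m})"
    if T: "card T \<ge> 2" "\<forall>y \<in> T. 0 < y \<and> y < x \<and> x - y \<in> T" for T
  proof -
    have fin: "finite T" using T(1) by (metis card.infinite not_numeral_le_zero)
    define m where "m = Min T"
    have ne: "T \<noteq> {}" using T(1) by auto
    have m: "m \<in> T" "\<forall>y \<in> T. m \<le> y" using fin ne by (auto simp: m_def)
    have "\<not> T \<subseteq> {m}"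
      using T(1) card_mono[of "{m}" T] by auto
    then obtain y where y: "y \<in> T" "y \<noteq> m" by blast
    \<comment> \<open>Both \<open>m < y\<close> and \<open>m \<le> x - y\<close> hold, and adding
      them gives the claim. Hence \<open>m\<close> and \<open>x - m\<close> differ, and two elements
      are removed.\<close>
    then have lt: "2 * m < x" using m T(2) by (metis add.commute add_less_le_mono le_neq_implies_less le_add_diff_inverse less_imp_le mult_2)
    have "card (T - {m, x - m}) + 2 = card T"
      using m T fin lt by (subst card_Diff_subset) auto
    moreover have "\<forall>y \<in> T - {m, x - m}. 0 < y \<and> y < x \<and> x - y \<in> T - {m, x - m}"
      using T(2) m(1) by force
    ultimately show ?thesis using lt m T(2) by blast
  qed
  have finV: "finite V" using assms(1) by (metis card.infinite zero_neq_numeral)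
  define T where "T = V - {x}"
  have T: "card T = 5" "\<forall>y \<in> T. 0 < y \<and> y < x \<and> x - y \<in> T"
  proof -
    show "card T = 5" using assms(1,2) finV by (simp add: T_def)
    show "\<forall>y \<in> T. 0 < y \<and> y < x \<and> x - y \<in> T"
    proof
      fix y assume y: "y \<in> T"
      then have "0 < y" "y < x" "x - y \<in> V"
        using assms(3) invol[of y] by (auto simp: T_def intro: gr0I)
      then show "0 < y \<and> y < x \<and> x - y \<in> T" by (auto simp: T_def)
    qed
  qed
  obtain a where a: "2 * a < x" "0 < a" "a \<in> T" "x - a \<in> T" "\<forall>y \<in> T. a \<le> y"
    "card (T - {a, x - a}) = 3"
    "\<forall>y \<in> T - {a, x - a}. 0 < y \<and> y < x \<and> x - y \<in> T - {a, x - a}"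
    using peel[of T] T by auto
  define U where "U = T - {a, x - a}"
  obtain b where b: "2 * b < x" "b \<in> U" "x - b \<in> U" "\<forall>y \<in> U. b \<le> y"
    "card (U - {b, x - b}) = 1"
    "\<forall>y \<in> U - {b, x - b}. 0 < y \<and> y < x \<and> x - y \<in> U - {b, x - b}"
    using peel[of U] a(6,7) unfolding U_def[symmetric] by auto
  obtain c where c: "U - {b, x - b} = {c}" using b(5) card_1_singletonE by blast
  have "x - c = c" "c < x" using b(6) c by auto
  then have x: "x = 2 * c" by simp
  have "a < b" using b(2) a(5) by (auto simp: U_def le_neq_implies_less)
  moreover have "b < c" using b(1) x by simp
  moreover have "V = {a, b, c, 2 * c - b, 2 * c - a, 2 * c}"
  proof -
    have "U = {b, x - b, c}" using b c by blast
    moreover have "T = {a, x - a} \<union> U" using a by (auto simp: U_def)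
    moreover have "V = insert x T" using assms(2) by (auto simp: T_def)
    ultimately show ?thesis unfolding x by auto
  qed
  ultimately show thesis using that a(2) x by blast
qed

section \<open>Isomorphisms from vertex labellings\<close>

text \<open>Both graphs are symmetric and loop-free, so comparing pairs with \<open>p < q\<close>
  suffices. The map on arcs is forced by the map on vertices.\<close>

lemma digraph_iso_graph_of_edges:
  fixes W :: "nat set" and f :: "nat \<Rightarrow> 'a"
  assumes G: "pair_graph G" and W: "finite W"
    and E: "\<forall>(p, q) \<in> E. p \<in> W \<and> q \<in> W \<and> p < q"
    and f: "inj_on f W" "f ` W = pverts G"
    and adj: "\<forall>p \<in> W. \<forall>q \<in> W. p < q \<longrightarrow> ((p, q) \<in> E \<longleftrightarrow> (f p, f q) \<in> parcs G)"
  shows "digraph_iso (with_proj G) (with_proj (graph_of_edges W E))"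
proof -
  interpret G: pair_graph G by (rule G)
  let ?H = "graph_of_edges W E"
  interpret H: pair_graph ?H using W E by (intro pair_graph_graph_of_edges) auto
  have sym: "(u, v) \<in> parcs G \<Longrightarrow> (v, u) \<in> parcs G" for u v
    using G.arcs_symmetric by blast
  have adj': "(p, q) \<in> parcs ?H \<longleftrightarrow> (f p, f q) \<in> parcs G" if "p \<in> W" "q \<in> W" for p q
  proof (cases p q rule: linorder_cases)
    case less
    have "(q, p) \<notin> E" using E less by auto
    then show ?thesis using adj that less by (simp add: graph_of_edges_def)
  next
    case equal
    have "(p, p) \<notin> E" using E by auto
    moreover have "(f p, f p) \<notin> parcs G" using G.no_loops' by blast
    ultimately show ?thesis using equal by (simp add: graph_of_edges_def)
  next
    case greater
    have "(p, q) \<notin> E" using E greater by auto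
    moreover have "(f p, f q) \<in> parcs G \<longleftrightarrow> (f q, f p) \<in> parcs G" using sym by blast
    ultimately show ?thesis using adj that greater by (simp add: graph_of_edges_def)
  qed
  have HW: "parcs ?H \<subseteq> W \<times> W" using E by (auto simp: graph_of_edges_def)
  have arcs: "parcs G = map_prod f f ` parcs ?H"
  proof
    show "parcs G \<subseteq> map_prod f f ` parcs ?H"
    proof clarify
      fix u v assume uv: "(u, v) \<in> parcs G"
      then have "u \<in> pverts G" "v \<in> pverts G" using G.in_arcsD1 G.in_arcsD2 by blast+
      then obtain p q where "p \<in> W" "q \<in> W" "u = f p" "v = f q" using f(2) by blast
      then show "(u, v) \<in> map_prod f f ` parcs ?H"
        using uv adj' by (auto intro!: image_eqI[of _ _ "(p, q)"])
    qed
    show "map_prod f f ` parcs ?H \<subseteq> parcs G" using HW adj' by auto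
  qed
  define h where "h = \<lparr> iso_verts = f, iso_arcs = map_prod f f, iso_head = snd, iso_tail = fst \<rparr>"
  have "inj_on (map_prod f f) (parcs ?H)"
    using map_prod_inj_on[OF f(1) f(1)] HW inj_on_subset by blast
  then have "pre_digraph.digraph_isomorphism (with_proj ?H) h"
    using f(1) H.wf_digraph
    by (auto simp: pre_digraph.digraph_isomorphism_def h_def graph_of_edges_def)
  moreover have "with_proj G = app_iso h (with_proj ?H)"
    using f(2) arcs by (auto simp: app_iso_def h_def with_proj_def graph_of_edges_def)
  ultimately have "digraph_iso (with_proj ?H) (with_proj G)"
    unfolding digraph_iso_def by blast
  then show ?thesis using H.wf_digraph digraph_iso_swap by blast
qed

lemma atLeastAtMost_1_6: "{1..6} = {1, 2, 3, 4, 5, 6 :: nat}"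
  by auto

text \<open>Reduces an isomorphism with a concrete graph to fifteen adjacency checks, with
  \<open>v1\<close> to \<open>v6\<close> labelled 1 to 6.\<close>

lemma digraph_iso_of_labelling:
  fixes E :: "(nat \<times> nat) set"
  assumes G: "pair_graph G" and d: "distinct [v1, v2, v3, v4, v5, v6]"
    and V: "pverts G = {v1, v2, v3, v4, v5, v6}"
    and E: "\<forall>(p, q) \<in> E. p \<in> {1..6} \<and> q \<in> {1..6} \<and> p < q"
    and "(1, 2) \<in> E \<longleftrightarrow> (v1, v2) \<in> parcs G" "(1, 3) \<in> E \<longleftrightarrow> (v1, v3) \<in> parcs G"
      "(1, 4) \<in> E \<longleftrightarrow> (v1, v4) \<in> parcs G" "(1, 5) \<in> E \<longleftrightarrow> (v1, v5) \<in> parcs G"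
      "(1, 6) \<in> E \<longleftrightarrow> (v1, v6) \<in> parcs G" "(2, 3) \<in> E \<longleftrightarrow> (v2, v3) \<in> parcs G"
      "(2, 4) \<in> E \<longleftrightarrow> (v2, v4) \<in> parcs G" "(2, 5) \<in> E \<longleftrightarrow> (v2, v5) \<in> parcs G"
      "(2, 6) \<in> E \<longleftrightarrow> (v2, v6) \<in> parcs G" "(3, 4) \<in> E \<longleftrightarrow> (v3, v4) \<in> parcs G"
      "(3, 5) \<in> E \<longleftrightarrow> (v3, v5) \<in> parcs G" "(3, 6) \<in> E \<longleftrightarrow> (v3, v6) \<in> parcs G"
      "(4, 5) \<in> E \<longleftrightarrow> (v4, v5) \<in> parcs G" "(4, 6) \<in> E \<longleftrightarrow> (v4, v6) \<in> parcs G"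
      "(5, 6) \<in> E \<longleftrightarrow> (v5, v6) \<in> parcs G"
  shows "digraph_iso (with_proj G) (with_proj (graph_of_edges {1..6} E))"
proof (rule digraph_iso_graph_of_edges[where f = "\<lambda>p. [v1, v2, v3, v4, v5, v6] ! (p - 1)"])
  let ?f = "\<lambda>p. [v1, v2, v3, v4, v5, v6] ! (p - 1)"
  show "inj_on ?f {1..6}" using d unfolding atLeastAtMost_1_6 by auto
  show "?f ` {1..6} = pverts G" unfolding V atLeastAtMost_1_6 by simp
  show "\<forall>p \<in> {1..6}. \<forall>q \<in> {1..6}. p < q \<longrightarrow> ((p, q) \<in> E \<longleftrightarrow> (?f p, ?f q) \<in> parcs G)"
    unfolding atLeastAtMost_1_6 using assms(5-19) by simp
qed (use G E in auto)

section \<open>Classification of the adjacency patterns\<close>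

text \<open>If \<open>u\<close> and \<open>v\<close> are vertices with \<open>u + v < x\<close>, then \<open>u + v\<close> is a vertex iff
  \<open>u + v + w = x\<close> for some vertex \<open>w\<close>. Apart from the pairs summing to \<open>x\<close>, this leaves only four
  pairs that may fail to be adjacent, and the hypotheses exclude half of the sixteen patterns.\<close>

lemma six_element_graph:
  fixes a b c A B x :: nat
  assumes G: "pair_graph G" and V: "pverts G = {a, b, c, B, A, x}"
    and ord: "0 < a" "a < b" "b < c" "c < B" "B < A" "A < x"
    and sums: "a + A = x" "b + B = x" "2 * c = x"
    and arcs: "\<And>u v. (u, v) \<in> parcs G \<longleftrightarrow>
      u \<in> pverts G \<and> v \<in> pverts G \<and> u \<noteq> v \<and> u + v \<notin> pverts G"
    and closed: "a + b = c \<Longrightarrow> b = 2 * a" "\<not> (b = 2 * a \<and> c = 4 * a)"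
  shows "\<exists>H \<in> {H1, H2, H3, H4, H5, H6}. digraph_iso (with_proj G) (with_proj H)"
proof -
  have comm: "(u, v) \<in> parcs G \<longleftrightarrow> (v, u) \<in> parcs G" for u v
    by (auto simp: arcs add.commute)
  \<comment> \<open>By size, \<open>a + b\<close> can only be the vertex \<open>c\<close>,
    \<open>B\<close> or \<open>A\<close>, the sums \<open>a + c\<close> and \<open>b + c\<close>
    only \<open>B\<close> or \<open>A\<close>, and \<open>a + B\<close> only \<open>A\<close>. These
    equations are rewritten using \<open>sums\<close>.\<close>
  have rel: "(a, b) \<in> parcs G \<longleftrightarrow> a + b \<noteq> c \<and> a + 2 * b \<noteq> x \<and> 2 * a + b \<noteq> x"
    "(a, c) \<in> parcs G \<longleftrightarrow> a + b \<noteq> c \<and> c \<noteq> 2 * a"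
    "(b, c) \<in> parcs G \<longleftrightarrow> a + b \<noteq> c \<and> c \<noteq> 2 * b"
    "(a, B) \<in> parcs G \<longleftrightarrow> b \<noteq> 2 * a"
    using ord sums unfolding arcs V by auto
  have nonadj: "(a, A) \<notin> parcs G" "(b, B) \<notin> parcs G" "(A, a) \<notin> parcs G" "(B, b) \<notin> parcs G"
    using sums unfolding arcs V by auto
  have large: "(u, v) \<in> parcs G" if "u \<in> pverts G" "v \<in> pverts G" "u \<noteq> v" "x < u + v" for u v
  proof -
    have "u + v \<notin> pverts G" using ord that(4) unfolding V by auto
    then show ?thesis using that arcs by blast
  qed
  have adj: "(b, A) \<in> parcs G" "(c, B) \<in> parcs G" "(c, A) \<in> parcs G" "(B, A) \<in> parcs G"
    "(a, x) \<in> parcs G" "(b, x) \<in> parcs G" "(c, x) \<in> parcs G" "(B, x) \<in> parcs G"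
    "(A, x) \<in> parcs G"
    by (rule large; use ord sums V in simp)+
  note facts = nonadj adj adj[THEN comm[THEN iffD1]] comm[of b a] comm[of c a] comm[of c b] comm[of B a]
  note iso = digraph_iso_of_labelling[OF G]
  \<comment> \<open>In the first line \<open>c = 3 * a\<close> and \<open>2 * b = 4 * a\<close>; in
    the third, \<open>x = 4 * b\<close> is too large for the last two equations.\<close>
  have excl: "a + b = c \<Longrightarrow> b = 2 * a \<and> c \<noteq> 2 * a \<and> c \<noteq> 2 * b"
    "b = 2 * a \<Longrightarrow> c \<noteq> 2 * a \<and> c \<noteq> 2 * b"
    "c = 2 * b \<Longrightarrow> c \<noteq> 2 * a \<and> a + 2 * b \<noteq> x \<and> 2 * a + b \<noteq> x"
    using closed ord sums by auto
  \<comment> \<open>In order, these are: \<open>a + b = c\<close>; \<open>b = 2 * a\<close> with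
    \<open>a + 2 * b = x\<close>; \<open>c = 2 * a\<close> with \<open>a + 2 * b = x\<close>; only
    \<open>b = 2 * a\<close>; only \<open>a + 2 * b = x\<close> or \<open>2 * a + b = x\<close>;
    only \<open>c = 2 * a\<close>; only \<open>c = 2 * b\<close>; no relation.\<close>
  consider
      "(a, b) \<notin> parcs G" "(a, c) \<notin> parcs G" "(b, c) \<notin> parcs G" "(a, B) \<notin> parcs G"
    | "(a, b) \<notin> parcs G" "(a, c) \<in> parcs G" "(b, c) \<in> parcs G" "(a, B) \<notin> parcs G"
    | "(a, b) \<notin> parcs G" "(a, c) \<notin> parcs G" "(b, c) \<in> parcs G" "(a, B) \<in> parcs G"
    | "(a, b) \<in> parcs G" "(a, c) \<in> parcs G" "(b, c) \<in> parcs G" "(a, B) \<notin> parcs G"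
    | "(a, b) \<notin> parcs G" "(a, c) \<in> parcs G" "(b, c) \<in> parcs G" "(a, B) \<in> parcs G"
    | "(a, b) \<in> parcs G" "(a, c) \<notin> parcs G" "(b, c) \<in> parcs G" "(a, B) \<in> parcs G"
    | "(a, b) \<in> parcs G" "(a, c) \<in> parcs G" "(b, c) \<notin> parcs G" "(a, B) \<in> parcs G"
    | "(a, b) \<in> parcs G" "(a, c) \<in> parcs G" "(b, c) \<in> parcs G" "(a, B) \<in> parcs G"
    using excl rel by satx
  then show ?thesis
  proof cases
    case 1
    \<comment> \<open>Each labelling matches degrees; \<open>x\<close>, adjacent to every other
      vertex, always receives a label of degree 5.\<close>
    then have "digraph_iso (with_proj G) (with_proj H1)"
      unfolding H1_def by (intro iso[of a x c B b A]) (use ord in \<open>auto simp: V facts\<close>)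
    then show ?thesis by simp
  next
    case 2
    then have "digraph_iso (with_proj G) (with_proj H2)"
      unfolding H2_def by (intro iso[of a x b B c A]) (use ord in \<open>auto simp: V facts\<close>)
    then show ?thesis by simp
  next
    case 3
    then have "digraph_iso (with_proj G) (with_proj H3)"
      unfolding H3_def by (intro iso[of a x c A B b]) (use ord in \<open>auto simp: V facts\<close>)
    then show ?thesis by simp
  next
    case 4
    then have "digraph_iso (with_proj G) (with_proj H4)"
      unfolding H4_def by (intro iso[of c x a A B b]) (use ord in \<open>auto simp: V facts\<close>)
    then show ?thesis by simp
  next
    \<comment> \<open>Exchanging \<open>b\<close> and \<open>B\<close> turns the preceding pattern
      into this one, so the graph is again \<open>H4\<close>.\<close>
    case 5
    then have "digraph_iso (with_proj G) (with_proj H4)"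
      unfolding H4_def by (intro iso[of c x a A b B]) (use ord in \<open>auto simp: V facts\<close>)
    then show ?thesis by simp
  next
    case 6
    then have "digraph_iso (with_proj G) (with_proj H5)"
      unfolding H5_def by (intro iso[of a x A b B c]) (use ord in \<open>auto simp: V facts\<close>)
    then show ?thesis by simp
  next
    \<comment> \<open>Exchanging \<open>a\<close> with \<open>b\<close> and \<open>A\<close> with
      \<open>B\<close> turns the preceding pattern into this one.\<close>
    case 7
    then have "digraph_iso (with_proj G) (with_proj H5)"
      unfolding H5_def by (intro iso[of b x B a A c]) (use ord in \<open>auto simp: V facts\<close>)
    then show ?thesis by simp
  next
    case 8
    then have "digraph_iso (with_proj G) (with_proj H6)"
      unfolding H6_def by (intro iso[of a c A b B x]) (use ord in \<open>auto simp: V facts\<close>)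
    then show ?thesis by simp
  qed
qed

section \<open>Degree sequences of the six graphs\<close>

lemma out_degree_graph_of_edges:
  "out_degree (with_proj (graph_of_edges V E)) v = card (E `` {v} \<union> E\<inverse> `` {v})"
proof -
  have "out_arcs (with_proj (graph_of_edges V E)) v = Pair v ` (E `` {v} \<union> E\<inverse> `` {v})"
    by (auto simp: out_arcs_def graph_of_edges_def)
  then show ?thesis by (simp add: out_degree_def card_image inj_on_def)
qed

text \<open>Replaces the multiset over \<open>{1..6}\<close> by an explicit list, so that concrete
  edge sets can be evaluated by simplification.\<close>

lemma degree_sequence_graph_of_edges:
  "degree_sequence (with_proj (graph_of_edges {1..6} E)) =
   sort (map (\<lambda>v. card (E `` {v} \<union> E\<inverse> `` {v})) [1, 2, 3, 4, 5, 6])"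
proof -
  let ?d = "\<lambda>v. card (E `` {v} \<union> E\<inverse> `` {v})"
  have "mset_set {1..6} = mset [1, 2, 3, 4, 5, 6 :: nat]"
    unfolding atLeastAtMost_1_6 by simp
  then have "image_mset ?d (mset_set {1..6}) = mset (map ?d [1, 2, 3, 4, 5, 6])"
    by (simp only: mset_map)
  moreover have "verts (with_proj (graph_of_edges {1..6} E)) = {1..6}"
    by (simp add: graph_of_edges_def)
  ultimately show ?thesis
    by (simp only: degree_sequence_def out_degree_graph_of_edges[abs_def] sorted_list_of_multiset_mset)
qed

text \<open>Stated with a union so that rewriting does not duplicate \<open>E `` {v}\<close> into both branches.\<close>

lemma Image_insert_singleton:
  "insert (p, q) E `` {v} = (if p = v then {q} else {}) \<union> E `` {v}"
  by auto

lemma converse_insert: "(insert (p, q) E)\<inverse> = insert (q, p) (E\<inverse>)"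
  by auto

lemma degree_sequences:
  "degree_sequence (with_proj H1) = [1, 2, 3, 3, 4, 5]"
  "degree_sequence (with_proj H2) = [2, 3, 3, 4, 5, 5]"
  "degree_sequence (with_proj H3) = [2, 3, 4, 4, 4, 5]"
  "degree_sequence (with_proj H4) = [3, 3, 4, 4, 5, 5]"
  "degree_sequence (with_proj H5) = [3, 4, 4, 4, 4, 5]"
  "degree_sequence (with_proj H6) = [4, 4, 4, 4, 5, 5]"
  unfolding H1_def H2_def H3_def H4_def H5_def H6_def degree_sequence_graph_of_edges
  by (simp_all add: Image_insert_singleton converse_insert del: One_nat_def)

theorem corollary2p6:
  fixes \<Lambda> I :: "nat set" and n :: nat
  assumes "numerical_semigroup \<Lambda>"
    and "embedding_dimension \<Lambda> = n"
    and "n \<ge> 2"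
    and "irreducible_ideal \<Lambda> I"
    and "card (verts (with_proj (ideal_graph \<Lambda> I))) = 6"
  shows "(\<exists>H \<in> {H1, H2, H3, H4, H5, H6}.
            digraph_iso (with_proj (ideal_graph \<Lambda> I)) (with_proj H)) \<and>
         degree_sequence (with_proj H1) = [1, 2, 3, 3, 4, 5] \<and>
         degree_sequence (with_proj H2) = [2, 3, 3, 4, 5, 5] \<and>
         degree_sequence (with_proj H3) = [2, 3, 4, 4, 4, 5] \<and>
         degree_sequence (with_proj H4) = [3, 3, 4, 4, 5, 5] \<and>
         degree_sequence (with_proj H5) = [3, 4, 4, 4, 4, 5] \<and>
         degree_sequence (with_proj H6) = [4, 4, 4, 4, 5, 5]"
proof -
  obtain x where x: "x \<in> \<Lambda>" and I: "I = {y \<in> \<Lambda>. \<not> (y \<le> x \<and> x - y \<in> \<Lambda>)}"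
    using irreducible_ideal_form assms(1,4) by blast
  have zero: "0 \<in> \<Lambda>" and add: "\<And>u v. u \<in> \<Lambda> \<Longrightarrow> v \<in> \<Lambda> \<Longrightarrow> u + v \<in> \<Lambda>"
    using assms(1) by (auto simp: numerical_semigroup_def nat_submonoid_def)
  have ideal: "semigroup_ideal \<Lambda> I"
    using assms(4) by (auto simp: irreducible_ideal_def proper_ideal_def)
  let ?G = "ideal_graph \<Lambda> I"
  have vert: "y \<in> pverts ?G \<longleftrightarrow> y \<noteq> 0 \<and> y \<in> \<Lambda> \<and> y \<le> x \<and> x - y \<in> \<Lambda>" for y
    by (auto simp: ideal_graph_def I)
  have summand: "u \<in> pverts ?G" if "u \<in> \<Lambda>" "v \<in> \<Lambda>" "u + v = x" "u \<noteq> 0" for u v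
  proof -
    have "x - u = v" using that(3) by simp
    then show ?thesis using that by (simp add: vert)
  qed
  \<comment> \<open>For vertices \<open>u\<close> and \<open>v\<close> the sum is a nonzero element
    of \<open>\<Lambda>\<close>, so it lies in \<open>I\<close> exactly when it is not a vertex.
    Thus the vertex set alone determines the graph.\<close>
  have arcs: "(u, v) \<in> parcs ?G \<longleftrightarrow>
      u \<in> pverts ?G \<and> v \<in> pverts ?G \<and> u \<noteq> v \<and> u + v \<notin> pverts ?G" for u v
    using add[of u v] by (auto simp: ideal_graph_def I)
  have card: "card (pverts ?G) = 6" using assms(5) by simp
  then have "\<exists>y. y \<in> pverts ?G" by (metis card.empty ex_in_conv zero_neq_numeral)
  then have "x \<noteq> 0" by (auto simp: vert)
  then have xV: "x \<in> pverts ?G" using x zero by (simp add: vert)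
  obtain a b c where abc: "0 < a" "a < b" "b < c" "x = 2 * c"
    and V: "pverts ?G = {a, b, c, 2 * c - b, 2 * c - a, 2 * c}"
  proof (rule involution_card_6[OF card xV])
    show "0 \<notin> pverts ?G" by (simp add: vert)
    fix y assume "y \<in> pverts ?G" "y \<noteq> x"
    then show "y < x \<and> x - y \<in> pverts ?G" by (auto simp: vert)
  qed
  have below: "y = a \<or> y = b" if "y \<in> pverts ?G" "y < c" for y
    using that abc unfolding V by auto
  have mem: "a \<in> \<Lambda>" "b \<in> \<Lambda>" using V vert by blast+
  have "\<exists>H \<in> {H1, H2, H3, H4, H5, H6}. digraph_iso (with_proj ?G) (with_proj H)"
  proof (rule six_element_graph[OF pair_graph_ideal_graph[OF assms(1) ideal] V])
    \<comment> \<open>Here \<open>2 * a + 2 * b = x\<close>, so \<open>2 * a\<close> is a vertex; it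
      lies below \<open>c\<close> and differs from \<open>a\<close>.\<close>
    show "b = 2 * a" if "a + b = c"
    proof -
      have "2 * a \<in> pverts ?G"
        using summand[of "2 * a" "2 * b"] add mem abc that by (simp add: mult_2)
      then show ?thesis using below[of "2 * a"] abc that by linarith
    qed
    \<comment> \<open>Here \<open>x = 8 * a\<close> is the sum of \<open>a + b = 3 * a\<close> and
      \<open>a + b + b = 5 * a\<close>, which would make \<open>3 * a\<close> a vertex strictly
      between \<open>b\<close> and \<open>c\<close>.\<close>
    show "\<not> (b = 2 * a \<and> c = 4 * a)"
    proof
      assume h: "b = 2 * a \<and> c = 4 * a"
      have "a + b \<in> \<Lambda>" "a + b + b \<in> \<Lambda>" using add mem by blast+
      then have "a + b \<in> pverts ?G"
        using summand[of "a + b" "a + b + b"] abc h by simp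
      then show False using below[of "a + b"] abc h by linarith
    qed
  qed (use abc arcs in auto)
  then show ?thesis by (simp only: degree_sequences simp_thms)
qed

end
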